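(* (1) The natural linear action of $\mathrm{GL}_2(\mathbb{R})$ on $\mathbb{R}^2$ is not Asplund representable. (2) The conjugation action $(g,x) \mapsto gxg^{-1}$ of the affine group $\mathbb{R}^2 \rtimes \mathrm{GL}_2(\mathbb{R})$ on itself is not Asplund representable; hence also the conjugation action of $\mathrm{GL}_3(\mathbb{R})$ on itself is not Asplund representable.
   Context: All topological spaces are assumed to be Tychonoff. For a topological group $G$, a $G$-space is a topological space $X$ with a continuous action $G \times X \to X$. For a Banach space $V$, $\mathrm{Iso}(V)$ is the topological group of linear isometries of $V$ onto itself with the strong operator topology; it acts on the dual $V^*$ by $(gu^* )(v) = u^*(g^{-1}v)$. A representation of a $G$-space $X$ on $V$ is a pair $(h,\alpha)$ where $h \colon G \to \mathrm{Iso}(V)$ is a continuous homomorphism and $\alpha \colon X \to V^*$ is a norm-bounded, weak-star continuous map that is equivariant: $\alpha(gx) = h(g)\alpha(x)$ for all $g \in G$, $x \in X$. The representation is proper if $\alpha$ is a topological embedding (with $V^*$ carrying the weak-star topology). A Banach space $V$ is Asplund if the dual $W^*$ of every separable Banach subspace $W$ of $V$ is separable. A $G$-space (or its action) is Asplund representable if it admits a proper representation on some Asplund Banach space $V$. The affine group $\mathbb{R}^2 \rtimes \mathrm{GL}_2(\mathbb{R})$ is the topological semidirect product with respect to the natural linear action of $\mathrm{GL}_2(\mathbb{R})$ on $\mathbb{R}^2$. *)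

theory Defs
  imports "HOL-Analysis.Analysis" "HOL-Algebra.Group"
begin

section \<open>Topological groups and \<open>G\<close>-spaces\<close>

definition tychonoff_space :: "'a topology \<Rightarrow> bool" where
  "tychonoff_space X \<longleftrightarrow> completely_regular_space X \<and> Hausdorff_space X"

locale topological_group = group G for G (structure) and T +
  assumes topspace_eq: "topspace T = carrier G"
    and tychonoff_group: "tychonoff_space T"
    and continuous_mult:
      "continuous_map (prod_topology T T) T (\<lambda>(x, y). x \<otimes> y)"
    and continuous_inv: "continuous_map T T (\<lambda>x. inv x)"

locale G_space = topological_group G T for G (structure) and T +
  fixes X :: "'x topology" and act :: "'a \<Rightarrow> 'x \<Rightarrow> 'x"
  assumes tychonoff: "tychonoff_space X"
    and continuous_act: "continuous_map (prod_topology T X) X (\<lambda>(g, x). act g x)"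
    and act_one: "x \<in> topspace X \<Longrightarrow> act \<one> x = x"
    and act_mult: "\<lbrakk>g \<in> carrier G; h \<in> carrier G; x \<in> topspace X\<rbrakk>
      \<Longrightarrow> act (g \<otimes> h) x = act g (act h x)"


section \<open>Representations on Banach spaces\<close>

definition Iso :: "('v::banach \<Rightarrow>\<^sub>L 'v) monoid" where
  "Iso = \<lparr>carrier = {S. (\<forall>v. norm (blinfun_apply S v) = norm v) \<and> surj (blinfun_apply S)},
          mult = (o\<^sub>L), one = id_blinfun\<rparr>"

definition Iso_topology :: "('v::banach \<Rightarrow>\<^sub>L 'v) topology" where
  "Iso_topology = subtopology strong_operator_topology (carrier Iso)"

text \<open>On \<open>V\<^sup>* = (V \<Rightarrow>\<^sub>L \<real>)\<close> the strong operator topology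
  is the topology of pointwise convergence, i.e. the weak-star topology.\<close>

abbreviation weak_star_topology :: "('v::banach \<Rightarrow>\<^sub>L real) topology" where
  "weak_star_topology \<equiv> strong_operator_topology"

definition dual_act :: "('v::banach \<Rightarrow>\<^sub>L 'v) \<Rightarrow> ('v \<Rightarrow>\<^sub>L real) \<Rightarrow> ('v \<Rightarrow>\<^sub>L real)" where
  "dual_act S u = u o\<^sub>L (inv\<^bsub>Iso\<^esub> S)"

definition representation ::
  "('g, 'b) monoid_scheme \<Rightarrow> 'g topology \<Rightarrow> 'x topology \<Rightarrow> ('g \<Rightarrow> 'x \<Rightarrow> 'x)
    \<Rightarrow> ('g \<Rightarrow> ('v::banach \<Rightarrow>\<^sub>L 'v)) \<Rightarrow> ('x \<Rightarrow> ('v \<Rightarrow>\<^sub>L real)) \<Rightarrow> bool" where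
  "representation G T X act h \<alpha> \<longleftrightarrow>
     h \<in> hom G Iso \<and> continuous_map T Iso_topology h \<and>
     bounded (\<alpha> ` topspace X) \<and> continuous_map X weak_star_topology \<alpha> \<and>
     (\<forall>g\<in>carrier G. \<forall>x\<in>topspace X. \<alpha> (act g x) = dual_act (h g) (\<alpha> x))"

definition proper_representation ::
  "('g, 'b) monoid_scheme \<Rightarrow> 'g topology \<Rightarrow> 'x topology \<Rightarrow> ('g \<Rightarrow> 'x \<Rightarrow> 'x)
    \<Rightarrow> ('g \<Rightarrow> ('v::banach \<Rightarrow>\<^sub>L 'v)) \<Rightarrow> ('x \<Rightarrow> ('v \<Rightarrow>\<^sub>L real)) \<Rightarrow> bool" where
  "proper_representation G T X act h \<alpha> \<longleftrightarrow>
     representation G T X act h \<alpha> \<and> embedding_map X weak_star_topology \<alpha>"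


section \<open>Asplund spaces\<close>

text \<open>The dual of a subspace \<open>W\<close>, as a set of functions that are \<open>undefined\<close> off \<open>W\<close>,
  with the metric of the dual norm. The guard in the metric makes it
  nonnegative on all functions, as the locale \<open>Metric_space\<close> demands.\<close>

definition dual_on :: "'v::real_normed_vector set \<Rightarrow> ('v \<Rightarrow> real) set" where
  "dual_on W = {f \<in> extensional W.
     (\<forall>x\<in>W. \<forall>y\<in>W. f (x + y) = f x + f y) \<and>
     (\<forall>c. \<forall>x\<in>W. f (c *\<^sub>R x) = c * f x) \<and>
     (\<exists>B. \<forall>x\<in>W. \<bar>f x\<bar> \<le> B * norm x)}"

definition dual_dist :: "'v::real_normed_vector set \<Rightarrow> ('v \<Rightarrow> real) \<Rightarrow> ('v \<Rightarrow> real) \<Rightarrow> real" where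
  "dual_dist W f g =
     (if f \<in> dual_on W \<and> g \<in> dual_on W
      then (SUP x\<in>{x \<in> W. norm x \<le> 1}. \<bar>f x - g x\<bar>) else 0)"

definition dual_topology :: "'v::real_normed_vector set \<Rightarrow> ('v \<Rightarrow> real) topology" where
  "dual_topology W = Metric_space.mtopology (dual_on W) (dual_dist W)"

definition asplund :: "'v::banach itself \<Rightarrow> bool" where
  "asplund _ \<longleftrightarrow>
     (\<forall>W :: 'v set. subspace W \<and> closed W \<and> separable_space (top_of_set W)
        \<longrightarrow> separable_space (dual_topology W))"

text \<open>HOL cannot quantify over types inside a formula, so the Banach space is a type argument.
  A \<open>G\<close>-space fails to be Asplund representable iff \<open>asplund_representable_on TYPE('v)\<close> fails
  for every \<open>'v\<close>, i.e. for a free type variable \<open>'v\<close> in a theorem.\<close>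

definition asplund_representable_on ::
  "'v::banach itself \<Rightarrow> ('g, 'b) monoid_scheme \<Rightarrow> 'g topology
    \<Rightarrow> 'x topology \<Rightarrow> ('g \<Rightarrow> 'x \<Rightarrow> 'x) \<Rightarrow> bool" where
  "asplund_representable_on V G T X act \<longleftrightarrow>
     asplund V \<and>
     (\<exists>(h :: 'g \<Rightarrow> ('v \<Rightarrow>\<^sub>L 'v)) (\<alpha> :: 'x \<Rightarrow> ('v \<Rightarrow>\<^sub>L real)).
        proper_representation G T X act h \<alpha>)"


section \<open>The groups and actions\<close>

definition GL :: "(real^'n^'n) monoid" where
  "GL = \<lparr>carrier = {A. invertible A}, mult = (**), one = mat 1\<rparr>"

definition GL_topology :: "(real^'n^'n) topology" where
  "GL_topology = top_of_set (carrier GL)"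

definition Aff :: "((real^'n) \<times> (real^'n^'n)) monoid" where
  "Aff = \<lparr>carrier = UNIV \<times> carrier GL,
          mult = (\<lambda>(v, A) (w, B). (v + A *v w, A ** B)),
          one = (0, mat 1)\<rparr>"

definition Aff_topology :: "((real^'n) \<times> (real^'n^'n)) topology" where
  "Aff_topology = prod_topology euclidean GL_topology"

definition conjugation :: "('g, 'b) monoid_scheme \<Rightarrow> 'g \<Rightarrow> 'g \<Rightarrow> 'g" where
  "conjugation G g x = g \<otimes>\<^bsub>G\<^esub> x \<otimes>\<^bsub>G\<^esub> inv\<^bsub>G\<^esub> g"


section \<open>The definitions above do define groups, metrics and \<open>G\<close>-spaces\<close>

lemma group_Iso: "group (Iso :: ('v::banach \<Rightarrow>\<^sub>L 'v) monoid)"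
proof (rule groupI)
  fix S :: "'v \<Rightarrow>\<^sub>L 'v" assume "S \<in> carrier Iso"
  then have n: "\<And>v. norm (blinfun_apply S v) = norm v" and s: "surj (blinfun_apply S)"
    by (auto simp: Iso_def)
  have i: "inj (blinfun_apply S)"
    by (rule injI) (metis blinfun.diff_right n norm_eq_zero right_minus_eq)
  let ?J = "Hilbert_Choice.inv (blinfun_apply S)"
  have SJ: "blinfun_apply S (?J v) = v" for v using s by (simp add: surj_f_inv_f)
  have bl: "bounded_linear ?J"
  proof (rule bounded_linear_intro[where K = 1])
    show "?J (x + y) = ?J x + ?J y" for x y
      by (rule injD[OF i]) (simp add: SJ blinfun.add_right)
    show "?J (r *\<^sub>R x) = r *\<^sub>R ?J x" for r x
      by (rule injD[OF i]) (simp add: SJ blinfun.scaleR_right)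
    show "norm (?J x) \<le> norm x * 1" for x using n[of "?J x"] by (simp add: SJ)
  qed
  have ap: "blinfun_apply (Blinfun ?J) = ?J" using bl by (rule bounded_linear_Blinfun_apply)
  have "surj ?J" using i by (rule inj_imp_surj_inv)
  moreover have "norm (?J x) = norm x" for x using n[of "?J x"] by (simp add: SJ)
  ultimately have "Blinfun ?J \<in> carrier Iso" by (simp add: Iso_def ap)
  moreover have "Blinfun ?J o\<^sub>L S = id_blinfun"
    by (rule blinfun_eqI) (simp add: ap i)
  ultimately show "\<exists>R\<in>carrier Iso. R \<otimes>\<^bsub>Iso\<^esub> S = \<one>\<^bsub>Iso\<^esub>" by (auto simp: Iso_def)
next
  fix S R :: "'v \<Rightarrow>\<^sub>L 'v" assume "S \<in> carrier Iso" "R \<in> carrier Iso"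
  then show "S \<otimes>\<^bsub>Iso\<^esub> R \<in> carrier Iso"
    using comp_surj[of "blinfun_apply R" "blinfun_apply S"] by (simp add: Iso_def o_def)
qed (auto simp: Iso_def intro!: blinfun_eqI)

lemma dual_act_apply:
  assumes "S \<in> carrier Iso" "blinfun_apply S v = w"
  shows "blinfun_apply (dual_act S u) w = blinfun_apply u v"
proof -
  interpret group "Iso :: ('a \<Rightarrow>\<^sub>L 'a) monoid" by (rule group_Iso)
  have "inv\<^bsub>Iso\<^esub> S o\<^sub>L S = id_blinfun"
    using l_inv[OF assms(1)] by (simp add: Iso_def)
  then have "blinfun_apply (inv\<^bsub>Iso\<^esub> S) w = v"
    by (metis assms(2) blinfun_apply_blinfun_compose blinfun_apply_id_blinfun id_apply)
  then show ?thesis by (simp add: dual_act_def)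
qed

lemma Metric_space_dual:
  assumes W: "subspace W"
  shows "Metric_space (dual_on W) (dual_dist W)"
proof
  let ?U = "{x \<in> W. norm x \<le> 1}"
  have ne: "0 \<in> ?U" using W by (simp add: subspace_0)
  have bdd: "bdd_above ((\<lambda>x. \<bar>f x - g x\<bar>) ` ?U)" if fg: "f \<in> dual_on W" "g \<in> dual_on W" for f g
  proof -
    obtain B where B: "\<And>x. x \<in> W \<Longrightarrow> \<bar>f x\<bar> \<le> B * norm x"
      using fg(1) unfolding dual_on_def by blast
    obtain C where C: "\<And>x. x \<in> W \<Longrightarrow> \<bar>g x\<bar> \<le> C * norm x"
      using fg(2) unfolding dual_on_def by blast
    show ?thesis
    proof (rule bdd_aboveI2)
      fix x assume x: "x \<in> ?U"
      have "B * norm x \<le> \<bar>B\<bar> * 1" "C * norm x \<le> \<bar>C\<bar> * 1"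
        using x by (intro mult_mono; simp)+
      then show "\<bar>f x - g x\<bar> \<le> \<bar>B\<bar> + \<bar>C\<bar>" using B[of x] C[of x] x by auto
    qed
  qed
  have up: "\<bar>f x - g x\<bar> \<le> dual_dist W f g"
    if "f \<in> dual_on W" "g \<in> dual_on W" "x \<in> ?U" for f g x
    using cSUP_upper[OF that(3) bdd[OF that(1,2)]] that by (simp add: dual_dist_def)
  show "0 \<le> dual_dist W f g" for f g
  proof (cases "f \<in> dual_on W \<and> g \<in> dual_on W")
    case True
    then show ?thesis using up[OF _ _ ne, of f g] by auto
  qed (auto simp: dual_dist_def)
  show "dual_dist W f g = dual_dist W g f" for f g
    by (simp add: dual_dist_def abs_minus_commute conj_commute)
  show "dual_dist W f g = 0 \<longleftrightarrow> f = g" if fg: "f \<in> dual_on W" "g \<in> dual_on W" for f g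
  proof
    assume z: "dual_dist W f g = 0"
    have "f x = g x" if x: "x \<in> W" for x
    proof (cases "x = 0")
      case True
      have *: "k 0 = 0" if k: "k \<in> dual_on W" for k
      proof -
        have "\<forall>c. \<forall>x\<in>W. k (c *\<^sub>R x) = c * k x" using k by (simp add: dual_on_def)
        then have "k (0 *\<^sub>R x) = 0 * k x" using x by blast
        then show ?thesis by simp
      qed
      show ?thesis using *[OF fg(1)] *[OF fg(2)] True by simp
    next
      case False
      let ?y = "inverse (norm x) *\<^sub>R x"
      have "?y \<in> ?U" using x W False by (simp add: subspace_scale)
      from up[OF fg this] z have "f ?y = g ?y" by simp
      moreover have "f ?y = inverse (norm x) * f x" "g ?y = inverse (norm x) * g x"
        using fg x by (auto simp: dual_on_def)
      ultimately show ?thesis using False by simp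
    qed
    moreover have "f \<in> extensional W" "g \<in> extensional W" using fg by (auto simp: dual_on_def)
    ultimately show "f = g" by (meson extensionalityI)
  next
    assume "f = g"
    moreover have "(\<lambda>x. 0::real) ` ?U = {0}" using ne by auto
    ultimately show "dual_dist W f g = 0" by (simp add: dual_dist_def)
  qed
  show "dual_dist W f k \<le> dual_dist W f g + dual_dist W g k"
    if fg: "f \<in> dual_on W" "g \<in> dual_on W" "k \<in> dual_on W" for f g k
  proof -
    have "(SUP x\<in>?U. \<bar>f x - k x\<bar>) \<le> dual_dist W f g + dual_dist W g k"
    proof (rule cSUP_least)
      show "?U \<noteq> {}" using ne by blast
      fix x assume x: "x \<in> ?U"
      show "\<bar>f x - k x\<bar> \<le> dual_dist W f g + dual_dist W g k"
        using up[OF fg(1,2) x] up[OF fg(2,3) x] by linarith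
    qed
    then show ?thesis using fg by (simp add: dual_dist_def)
  qed
qed

lemma tychonoff_metrizable: "metrizable_space X \<Longrightarrow> tychonoff_space X"
  by (simp add: tychonoff_space_def metrizable_imp_Hausdorff_space
      metrizable_imp_completely_regular_space)

lemma metrizable_GL: "metrizable_space (GL_topology :: (real^'n^'n) topology)"
  by (simp add: GL_topology_def metrizable_space_subtopology metrizable_space_euclidean)

lemma group_GL: "group (GL :: (real^'n^'n) monoid)"
proof (rule groupI)
  fix A :: "real^'n^'n" assume "A \<in> carrier GL"
  then show "\<exists>B\<in>carrier GL. B \<otimes>\<^bsub>GL\<^esub> A = \<one>\<^bsub>GL\<^esub>"
    by (auto simp: GL_def invertible_def)
next
  show "\<one>\<^bsub>GL\<^esub> \<in> carrier (GL :: (real^'n^'n) monoid)"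
    by (auto simp: GL_def invertible_def intro!: exI[of _ "mat 1"])
qed (auto simp: GL_def invertible_mult matrix_mul_assoc)

lemma inv_GL:
  assumes "A \<in> carrier GL"
  shows "inv\<^bsub>GL\<^esub> A = matrix_inv A"
proof -
  interpret group "GL :: (real^'a^'a) monoid" by (rule group_GL)
  have i: "invertible A" using assms by (simp add: GL_def)
  have "A ** matrix_inv A = mat 1 \<and> matrix_inv A ** A = mat 1"
    using i unfolding matrix_inv_def invertible_def by (rule someI_ex)
  moreover from this have "invertible (matrix_inv A)" by (auto simp: invertible_def)
  ultimately show ?thesis
    using assms by (intro inv_equality) (auto simp: GL_def)
qed

lemma continuous_on_matrix_matrix_mult:
  fixes f g :: "'a::topological_space \<Rightarrow> real^'n^'n"
  assumes "continuous_on S f" "continuous_on S g"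
  shows "continuous_on S (\<lambda>x. f x ** g x)"
  unfolding matrix_matrix_mult_def by (intro continuous_intros assms)

lemma continuous_on_matrix_vector_mult:
  fixes f :: "'a::topological_space \<Rightarrow> real^'n^'n" and g :: "'a \<Rightarrow> real^'n"
  assumes "continuous_on S f" "continuous_on S g"
  shows "continuous_on S (\<lambda>x. f x *v g x)"
  unfolding matrix_vector_mult_def by (intro continuous_intros assms)

lemma continuous_on_det:
  fixes f :: "'a::topological_space \<Rightarrow> real^'n^'n"
  assumes "\<And>i j. continuous_on S (\<lambda>x. f x $ i $ j)"
  shows "continuous_on S (\<lambda>x. det (f x))"
  unfolding det_def by (intro continuous_intros assms)

lemma continuous_on_matrix_inv:
  "continuous_on {A::real^'n^'n. invertible A} matrix_inv"
proof -
  let ?M = "\<lambda>(A::real^'n^'n) k l. (\<chi> i j. if j = k then axis l 1 $ i else A $ i $ j) :: real^'n^'n"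
  have eq: "(\<chi> k l. det (?M A k l) / det A) = matrix_inv A" if "invertible A" for A :: "real^'n^'n"
  proof -
    have d: "det A \<noteq> 0" using that by (simp add: invertible_det_nz)
    have AA: "A ** matrix_inv A = mat 1"
      using someI_ex[OF that[unfolded invertible_def]] unfolding matrix_inv_def by blast
    have "matrix_inv A $ k $ l = det (?M A k l) / det A" for k l
    proof -
      have "A *v (matrix_inv A *v axis l 1) = axis l 1"
        by (simp add: matrix_vector_mul_assoc AA)
      then have "matrix_inv A *v axis l 1 = (\<chi> k. det (?M A k l) / det A)"
        using cramer[OF d] by blast
      then have "(matrix_inv A *v axis l 1) $ k = det (?M A k l) / det A" by simp
      then show ?thesis by (simp add: matrix_vector_mul_component inner_axis)
    qed
    then show ?thesis by (simp add: vec_eq_iff)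
  qed
  have ij: "continuous_on {A::real^'n^'n. invertible A} (\<lambda>A. ?M A k l $ i $ j)" for k l i j
    by (cases "j = k") (auto intro!: continuous_intros)
  have "continuous_on {A::real^'n^'n. invertible A} (\<lambda>A. det (?M A k l) / det A)" for k l
    by (rule continuous_on_divide[OF continuous_on_det[OF ij] continuous_on_det])
      (auto simp: invertible_det_nz intro!: continuous_intros)
  then have "continuous_on {A::real^'n^'n. invertible A} (\<lambda>A. \<chi> k l. det (?M A k l) / det A)"
    by (intro continuous_on_vec_lambda)
  then show ?thesis by (rule continuous_on_eq) (simp add: eq)
qed

lemma topological_group_GL: "topological_group (GL :: (real^'n^'n) monoid) GL_topology"
proof -
  interpret group "GL :: (real^'n^'n) monoid" by (rule group_GL)
  show ?thesis
  proof
    show "topspace GL_topology = carrier (GL :: (real^'n^'n) monoid)"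
      by (simp add: GL_topology_def)
    show "tychonoff_space (GL_topology :: (real^'n^'n) topology)"
      by (rule tychonoff_metrizable) (rule metrizable_GL)
    show "continuous_map (prod_topology GL_topology GL_topology) GL_topology
        (\<lambda>(x::real^'n^'n, y). x \<otimes>\<^bsub>GL\<^esub> y)"
      unfolding GL_topology_def prod_topology_subtopology euclidean_product_topology
        subtopology_subtopology
      by (auto simp: continuous_map_in_subtopology case_prod_unfold GL_def invertible_mult
          intro!: continuous_on_matrix_matrix_mult continuous_intros)
    have "continuous_map GL_topology GL_topology (matrix_inv :: real^'n^'n \<Rightarrow> _)"
    proof -
      have "matrix_inv A \<in> carrier GL" if "A \<in> carrier GL" for A :: "real^'n^'n"
        using inv_closed[OF that] inv_GL[OF that] by simp
      then show ?thesis
        using continuous_on_matrix_inv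
        by (auto simp: GL_topology_def continuous_map_in_subtopology GL_def)
    qed
    then show "continuous_map GL_topology GL_topology (\<lambda>x::real^'n^'n. inv\<^bsub>GL\<^esub> x)"
      by (rule continuous_map_eq) (simp add: GL_topology_def inv_GL)
  qed
qed

lemma group_Aff: "group (Aff :: ((real^'n) \<times> (real^'n^'n)) monoid)"
proof (rule groupI)
  interpret group "GL :: (real^'n^'n) monoid" by (rule group_GL)
  fix x :: "(real^'n) \<times> (real^'n^'n)" assume "x \<in> carrier Aff"
  then obtain v A where x: "x = (v, A)" "A \<in> carrier GL" by (auto simp: Aff_def)
  let ?B = "inv\<^bsub>GL\<^esub> A"
  have "?B ** A = mat 1" using l_inv[OF x(2)] by (simp add: GL_def)
  then show "\<exists>y\<in>carrier Aff. y \<otimes>\<^bsub>Aff\<^esub> x = \<one>\<^bsub>Aff\<^esub>"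
    using x by (intro bexI[of _ "(- (?B *v v), ?B)"]) (auto simp: Aff_def)
next
  interpret group "GL :: (real^'n^'n) monoid" by (rule group_GL)
  show "\<one>\<^bsub>Aff\<^esub> \<in> carrier (Aff :: ((real^'n) \<times> (real^'n^'n)) monoid)"
    using one_closed by (auto simp: Aff_def GL_def)
  fix x y :: "(real^'n) \<times> (real^'n^'n)" assume "x \<in> carrier Aff" "y \<in> carrier Aff"
  then show "x \<otimes>\<^bsub>Aff\<^esub> y \<in> carrier Aff"
    by (auto simp: Aff_def GL_def invertible_mult)
qed (auto simp: Aff_def matrix_mul_assoc matrix_vector_mul_assoc matrix_vector_right_distrib)

lemma inv_Aff:
  assumes "A \<in> carrier GL"
  shows "inv\<^bsub>Aff\<^esub> (v, A) = (- (matrix_inv A *v v), matrix_inv A)"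
proof -
  interpret a: group "Aff :: ((real^'a) \<times> (real^'a^'a)) monoid" by (rule group_Aff)
  interpret g: group "GL :: (real^'a^'a) monoid" by (rule group_GL)
  have "matrix_inv A \<in> carrier GL" "matrix_inv A ** A = mat 1"
    using g.inv_closed[OF assms] g.l_inv[OF assms] inv_GL[OF assms] by (auto simp: GL_def)
  then show ?thesis using assms by (intro a.inv_equality) (auto simp: Aff_def)
qed

lemma topological_group_Aff:
  "topological_group (Aff :: ((real^'n) \<times> (real^'n^'n)) monoid) Aff_topology"
proof -
  interpret group "Aff :: ((real^'n) \<times> (real^'n^'n)) monoid" by (rule group_Aff)
  have T: "Aff_topology = top_of_set (carrier (Aff :: ((real^'n) \<times> (real^'n^'n)) monoid))"
    unfolding Aff_topology_def GL_topology_def Aff_def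
    by (simp add: prod_topology_subtopology(2) flip: euclidean_product_topology)
  show ?thesis
  proof
    show "topspace Aff_topology = carrier (Aff :: ((real^'n) \<times> (real^'n^'n)) monoid)"
      by (simp add: T)
    show "tychonoff_space (Aff_topology :: ((real^'n) \<times> (real^'n^'n)) topology)"
      unfolding T
      by (intro tychonoff_metrizable metrizable_space_subtopology metrizable_space_euclidean)
    have c: "continuous_on (carrier Aff \<times> carrier Aff)
       (\<lambda>z. (fst (fst z) + snd (fst z) *v fst (snd z),
             (snd (fst z) :: real^'n^'n) ** snd (snd z)))"
      by (intro continuous_on_matrix_matrix_mult continuous_on_matrix_vector_mult continuous_intros)
    show "continuous_map (prod_topology Aff_topology Aff_topology) Aff_topology
        (\<lambda>(x::(real^'n) \<times> (real^'n^'n), y). x \<otimes>\<^bsub>Aff\<^esub> y)"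
    proof -
      have "(\<lambda>(x::(real^'n) \<times> (real^'n^'n), y). x \<otimes>\<^bsub>Aff\<^esub> y) =
        (\<lambda>z. (fst (fst z) + snd (fst z) *v fst (snd z), snd (fst z) ** snd (snd z)))"
        by (auto simp: Aff_def fun_eq_iff)
      moreover have "(\<lambda>(x::(real^'n) \<times> (real^'n^'n), y). x \<otimes>\<^bsub>Aff\<^esub> y) \<in>
        carrier Aff \<times> carrier Aff \<rightarrow> carrier Aff" by auto
      ultimately show ?thesis
        unfolding T prod_topology_subtopology euclidean_product_topology subtopology_subtopology
        using c by (auto simp: continuous_map_in_subtopology Times_Int_Times)
    qed
    have c: "continuous_on (carrier Aff)
       (\<lambda>z. (- (matrix_inv (snd z) *v fst z), matrix_inv (snd z) :: real^'n^'n))"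
      by (intro continuous_on_matrix_vector_mult continuous_intros
          continuous_on_compose2[OF continuous_on_matrix_inv])
        (auto simp: Aff_def GL_def)
    have "continuous_on (carrier Aff) (\<lambda>z::(real^'n) \<times> (real^'n^'n). inv\<^bsub>Aff\<^esub> z)"
      using c by (rule continuous_on_eq) (auto simp: Aff_def inv_Aff[unfolded Aff_def])
    then show "continuous_map Aff_topology Aff_topology
        (\<lambda>z::(real^'n) \<times> (real^'n^'n). inv\<^bsub>Aff\<^esub> z)"
      unfolding T by (auto simp: continuous_map_in_subtopology)
  qed
qed

lemma (in topological_group) G_space_conjugation: "G_space G T T (conjugation G)"
proof unfold_locales
  let ?P = "prod_topology T T"
  have m: "continuous_map ?P T (\<lambda>z. f z \<otimes> g z)"
    if "continuous_map ?P T f" "continuous_map ?P T g" for f g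
    using continuous_map_compose[OF continuous_map_pairedI[OF that] continuous_mult]
    by (simp add: o_def)
  have "continuous_map ?P T (\<lambda>z. fst z \<otimes> snd z \<otimes> inv (fst z))"
    by (intro m continuous_map_fst continuous_map_snd
        continuous_map_compose[OF continuous_map_fst continuous_inv, unfolded o_def])
  then show "continuous_map ?P T (\<lambda>(g, x). conjugation G g x)"
    by (simp add: conjugation_def case_prod_unfold)
qed (auto simp: tychonoff_group topspace_eq conjugation_def inv_mult_group m_assoc)

lemma G_space_GL: "G_space (GL :: (real^'n^'n) monoid) GL_topology euclidean (*v)"
proof -
  interpret topological_group "GL :: (real^'n^'n) monoid" GL_topology
    by (rule topological_group_GL)
  show ?thesis
  proof unfold_locales
    show "tychonoff_space (euclidean :: (real^'n) topology)"
      by (rule tychonoff_metrizable) (rule metrizable_space_euclidean)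
    have "continuous_on (carrier GL \<times> UNIV) (\<lambda>z. (fst z :: real^'n^'n) *v snd z)"
      by (intro continuous_on_matrix_vector_mult continuous_intros)
    then show "continuous_map (prod_topology GL_topology euclidean) euclidean
        (\<lambda>(A::real^'n^'n, x). A *v x)"
      by (simp add: GL_topology_def prod_topology_subtopology(1) case_prod_unfold)
  qed (auto simp: GL_def matrix_vector_mul_assoc)
qed

end

theory Submission
  imports Defs
begin

text \<open>Let \<open>GL\<^sub>2\<close> act by a representation \<open>(h, \<alpha>)\<close> on an Asplund space, and fix a vector \<open>v\<close>.
  The orbit of \<open>v\<close> spans a separable closed subspace \<open>W\<close>, so the functionals \<open>\<alpha> x\<close> restricted to
  \<open>W\<close> form a norm separable set. Among the uncountably many vectors \<open>(1, t)\<close> there are thus two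
  distinct ones, \<open>p\<close> and \<open>q\<close>, whose functionals are \<open>\<epsilon>\<close>-close on the whole orbit of \<open>v\<close>, that is,
  \<open>\<alpha> (A p) v\<close> and \<open>\<alpha> (A q) v\<close> are \<open>\<epsilon>\<close>-close for all \<open>A\<close> at once. Since \<open>GL\<^sub>2\<close> is transitive on
  bases, \<open>\<alpha> x v\<close> and \<open>\<alpha> y v\<close> are \<open>\<epsilon>\<close>-close for all independent \<open>x\<close> and \<open>y\<close>. Hence \<open>\<alpha>\<close> is
  constant off the origin and is not injective. The two conjugation actions contain this
  linear action, as the action of a subgroup on an invariant subset.\<close>

section \<open>Separable closed subspaces containing a given set\<close>

text \<open>Asking for rational scalars only leaves room for \<open>Q\<close> to be countable. A
  real multiple of a limit point is the limit of rational multiples of points of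
  \<open>Q\<close>.\<close>

lemma subspace_closure_of_rational_subspace:
  fixes Q :: "'v::real_normed_vector set"
  assumes "0 \<in> Q" and add: "\<And>x y. \<lbrakk>x \<in> Q; y \<in> Q\<rbrakk> \<Longrightarrow> x + y \<in> Q"
    and scale: "\<And>r x. \<lbrakk>r \<in> \<rat>; x \<in> Q\<rbrakk> \<Longrightarrow> r *\<^sub>R x \<in> Q"
  shows "subspace (closure Q)"
proof (rule subspaceI)
  show "0 \<in> closure Q" using assms(1) closure_subset by blast
next
  fix x y assume "x \<in> closure Q" "y \<in> closure Q"
  then obtain a b where ab: "\<And>n. a n \<in> Q" "a \<longlonglongrightarrow> x" "\<And>n. b n \<in> Q" "b \<longlonglongrightarrow> y"
    unfolding closure_sequential by blast
  have "(\<lambda>n. a n + b n) \<longlonglongrightarrow> x + y" using ab(2,4) by (rule tendsto_add)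
  moreover have "a n + b n \<in> Q" for n by (rule add[OF ab(1,3)])
  ultimately show "x + y \<in> closure Q"
    unfolding closure_sequential by (intro exI[of _ "\<lambda>n. a n + b n"]) simp
next
  fix c :: real and x assume "x \<in> closure Q"
  then obtain a where a: "\<And>n. a n \<in> Q" "a \<longlonglongrightarrow> x"
    unfolding closure_sequential by blast
  have "c \<in> closure \<rat>" by (simp add: Rats_closure_real)
  then obtain r where r: "\<And>n. r n \<in> \<rat>" "r \<longlonglongrightarrow> c"
    unfolding closure_sequential by blast
  have "(\<lambda>n. r n *\<^sub>R a n) \<longlonglongrightarrow> c *\<^sub>R x" using r(2) a(2) by (rule tendsto_scaleR)
  moreover have "r n *\<^sub>R a n \<in> Q" for n by (rule scale[OF r(1) a(1)])
  ultimately show "c *\<^sub>R x \<in> closure Q"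
    unfolding closure_sequential by (intro exI[of _ "\<lambda>n. r n *\<^sub>R a n"]) simp
qed

lemma countable_subset_separable_subspace:
  fixes D :: "'v::real_normed_vector set"
  assumes "countable D"
  obtains W where "subspace W" "closed W" "separable_space (top_of_set W)" "D \<subseteq> W"
proof -
  \<comment> \<open>Rational combinations are coded by lists, so that countability of lists gives
    countability of \<open>Q\<close>, and addition becomes concatenation.\<close>
  define comb where "comb = (\<lambda>l :: (real \<times> 'v) list. \<Sum>(r, d)\<leftarrow>l. r *\<^sub>R d)"
  define Q where "Q = comb ` lists (\<rat> \<times> D)"
  have cQ: "countable Q"
    unfolding Q_def using assms
    by (intro countable_image countable_lists countable_SIGMA countable_rat)
  have "subspace (closure Q)"
  proof (rule subspace_closure_of_rational_subspace)
    have "comb [] = 0" by (simp add: comb_def)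
    then show "0 \<in> Q" unfolding Q_def by (metis image_eqI lists.Nil)
    show "x + y \<in> Q" if xy: "x \<in> Q" "y \<in> Q" for x y
    proof -
      obtain k l where "k \<in> lists (\<rat> \<times> D)" "l \<in> lists (\<rat> \<times> D)" "x = comb k" "y = comb l"
        using xy unfolding Q_def by blast
      then have "x + y = comb (k @ l)" "k @ l \<in> lists (\<rat> \<times> D)"
        by (auto simp: comb_def)
      then show ?thesis unfolding Q_def by blast
    qed
    show "r *\<^sub>R x \<in> Q" if r: "r \<in> \<rat>" and x: "x \<in> Q" for r x
    proof -
      obtain l where l: "l \<in> lists (\<rat> \<times> D)" "x = comb l" using x unfolding Q_def by blast
      have "r *\<^sub>R comb k = comb (map (\<lambda>(s, d). (r * s, d)) k)" for k
        by (induction k) (auto simp: comb_def scaleR_right_distrib)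
      moreover have "map (\<lambda>(s, d). (r * s, d)) l \<in> lists (\<rat> \<times> D)"
        using l(1) r by (auto simp: in_lists_conv_set)
      ultimately show ?thesis unfolding Q_def using l(2) by blast
    qed
  qed
  moreover have "separable_space (top_of_set (closure Q))"
    unfolding separable_space_def
    using cQ closure_subset[of Q]
    by (intro exI[of _ Q]) (simp add: closure_of_subtopology Int_absorb1)
  moreover have "D \<subseteq> closure Q"
  proof
    fix d assume "d \<in> D"
    then have "[(1, d)] \<in> lists (\<rat> \<times> D)" by simp
    moreover have "comb [(1, d)] = d" by (simp add: comb_def)
    ultimately have "d \<in> Q" unfolding Q_def by (metis image_eqI)
    then show "d \<in> closure Q" using closure_subset by blast
  qed
  ultimately show thesis using that by blast
qed

text \<open>Take \<open>W\<close> around the image of a countable dense subset of \<open>S\<close>.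
  The preimage of \<open>W\<close> is relatively closed in \<open>S\<close> and contains that dense
  subset, so it is all of \<open>S\<close>.\<close>

lemma continuous_image_subset_separable_subspace:
  fixes f :: "'a::{metric_space, second_countable_topology} \<Rightarrow> 'v::real_normed_vector"
  assumes "continuous_on S f"
  obtains W where "subspace W" "closed W" "separable_space (top_of_set W)" "f ` S \<subseteq> W"
proof -
  obtain T where T: "countable T" "T \<subseteq> S" "S \<subseteq> closure T"
    by (rule separable[of S])
  obtain W where W: "subspace W" "closed W" "separable_space (top_of_set W)" "f ` T \<subseteq> W"
    by (rule countable_subset_separable_subspace[OF countable_image[OF T(1)]])
  have "closedin (top_of_set S) (S \<inter> f -` W)"
    using assms W(2) by (rule continuous_closedin_preimage)
  then obtain K where K: "closed K" "S \<inter> f -` W = S \<inter> K"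
    unfolding closedin_closed by blast
  have "T \<subseteq> K" using T(2) W(4) K(2) by blast
  then have "closure T \<subseteq> K" using K(1) by (rule closure_minimal)
  then have "f ` S \<subseteq> W" using T(3) K(2) by blast
  with W that show thesis by blast
qed

section \<open>Separability of the dual of a subspace of an Asplund space\<close>

lemma restrict_blinfun_in_dual_on:
  fixes u :: "'v::real_normed_vector \<Rightarrow>\<^sub>L real"
  assumes "subspace W"
  shows "restrict (blinfun_apply u) W \<in> dual_on W"
proof -
  have "\<bar>u x\<bar> \<le> norm u * norm x" for x using norm_blinfun[of u x] by simp
  then show ?thesis
    using assms by (auto simp: dual_on_def subspace_add subspace_scale blinfun.add_right
      blinfun.scaleR_right)
qed

text \<open>This trades the dual metric for uniform closeness on the unit ball of \<open>W\<close>.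
  The norm of \<open>u - v\<close> supplies the upper bound without which a real supremum says
  nothing.\<close>

lemma abs_diff_le_dual_dist:
  fixes u v :: "'v::real_normed_vector \<Rightarrow>\<^sub>L real"
  assumes W: "subspace W" and x: "x \<in> W" "norm x \<le> 1"
  shows "\<bar>u x - v x\<bar> \<le> dual_dist W (restrict u W) (restrict v W)"
proof -
  let ?U = "{x \<in> W. norm x \<le> 1}"
  have "bdd_above ((\<lambda>x. \<bar>restrict u W x - restrict v W x\<bar>) ` ?U)"
  proof (rule bdd_aboveI2)
    fix x assume x: "x \<in> ?U"
    have "\<bar>u x - v x\<bar> \<le> norm (u - v) * norm x"
      using norm_blinfun[of "u - v" x] by (simp add: blinfun.diff_left)
    also have "\<dots> \<le> norm (u - v) * 1" using x by (intro mult_left_mono) auto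
    finally show "\<bar>restrict u W x - restrict v W x\<bar> \<le> norm (u - v)" using x by simp
  qed
  from cSUP_upper[OF _ this, of x] show ?thesis
    using x restrict_blinfun_in_dual_on[OF W, of u] restrict_blinfun_in_dual_on[OF W, of v]
    by (simp add: dual_dist_def)
qed

text \<open>Pigeonhole: each restricted functional lies within \<open>e / 2\<close> of some member
  of a countable dense set, so two of the uncountably many indices share that member.\<close>

lemma asplund_uncountable_family_close_pair:
  fixes \<beta> :: "real \<Rightarrow> ('v::banach \<Rightarrow>\<^sub>L real)"
  assumes "asplund TYPE('v)" and W: "subspace W" "closed W" "separable_space (top_of_set W)"
    and e: "e > 0"
  obtains s t where "s \<noteq> t" "\<And>w. \<lbrakk>w \<in> W; norm w \<le> 1\<rbrakk> \<Longrightarrow> \<bar>\<beta> s w - \<beta> t w\<bar> < e"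
proof -
  interpret Metric_space "dual_on W" "dual_dist W" by (rule Metric_space_dual[OF W(1)])
  have "separable_space mtopology"
    using assms unfolding asplund_def dual_topology_def by blast
  then obtain D where D: "countable D" "D \<subseteq> dual_on W" "mtopology closure_of D = dual_on W"
    unfolding separable_space_def by auto
  define r where "r t = restrict (\<beta> t) W" for t
  have r: "r t \<in> dual_on W" for t
    unfolding r_def by (rule restrict_blinfun_in_dual_on[OF W(1)])
  have "\<exists>d\<in>D. dual_dist W (r t) d < e / 2" for t
  proof -
    have "r t \<in> mtopology closure_of D" using r D(3) by simp
    moreover have "0 < e / 2" using e by simp
    ultimately have "\<exists>d\<in>D. d \<in> mball (r t) (e / 2)"
      unfolding metric_closure_of by blast
    then show ?thesis by auto
  qed
  then obtain d where d: "\<And>t. d t \<in> D" "\<And>t. dual_dist W (r t) (d t) < e / 2"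
    by metis
  have "\<not> inj d"
  proof
    assume "inj d"
    moreover have "countable (range d)"
      by (rule countable_subset[OF _ D(1)]) (use d(1) in blast)
    ultimately show False
      using countable_image_inj_on uncountable_UNIV_real by blast
  qed
  then obtain s t where st: "s \<noteq> t" "d s = d t" unfolding inj_def by blast
  have "dual_dist W (r s) (r t) \<le> dual_dist W (r s) (d s) + dual_dist W (d s) (r t)"
    using r d(1) D(2) by (intro triangle) auto
  also have "\<dots> < e" using d(2)[of s] d(2)[of t] st(2) commute[of "d t" "r t"] by simp
  finally have "dual_dist W (r s) (r t) < e" .
  then have "\<bar>\<beta> s w - \<beta> t w\<bar> < e" if "w \<in> W" "norm w \<le> 1" for w
    using abs_diff_le_dual_dist[OF W(1) that, of "\<beta> s" "\<beta> t"] unfolding r_def by linarith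
  with st(1) that show thesis by blast
qed

section \<open>The linear action on the plane\<close>

text \<open>Both assumptions say that a determinant is nonzero. The matrix with columns
  \<open>x\<close>, \<open>y\<close> times the inverse of the one with columns \<open>p\<close>,
  \<open>q\<close> passes through the standard basis.\<close>

lemma GL2_transitive_on_bases:
  fixes p q x y :: "real^2"
  assumes "p$1 * q$2 \<noteq> p$2 * q$1" "x$1 * y$2 \<noteq> x$2 * y$1"
  obtains A :: "real^2^2" where "invertible A" "A *v p = x" "A *v q = y"
proof -
  define M :: "real^2 \<Rightarrow> real^2 \<Rightarrow> real^2^2"
    where "M a b = vector [vector [a$1, b$1], vector [a$2, b$2]]" for a b
  have M: "M a b *v axis 1 1 = a" "M a b *v axis 2 1 = b" for a b
    by (simp_all add: M_def vec_eq_iff forall_2 matrix_vector_mult_def sum_2 axis_def)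
  have inv: "invertible (M a b)" if "a$1 * b$2 \<noteq> a$2 * b$1" for a b
    using that by (simp add: invertible_det_nz M_def det_2 mult.commute)
  obtain P where P: "P ** M p q = mat 1" "M p q ** P = mat 1"
    using inv[OF assms(1)] unfolding invertible_def by blast
  have Pp: "P *v p = axis 1 1" "P *v q = axis 2 1"
    using P(1) M[of p q] by (metis matrix_vector_mul_assoc matrix_vector_mul_lid)+
  have "invertible P" using P unfolding invertible_def by blast
  then have "invertible (M x y ** P)"
    using inv[OF assms(2)] by (simp add: invertible_mult)
  moreover have "(M x y ** P) *v p = x" "(M x y ** P) *v q = y"
    by (simp_all add: Pp M flip: matrix_vector_mul_assoc)
  ultimately show thesis by (rule that)
qed

text \<open>Equivariance moves the group element from the point to the vector, so the values at
  \<open>v\<close> of the functionals along the orbit of \<open>x\<close> are values of the single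
  functional \<open>\<alpha> x\<close> on the orbit of \<open>v\<close>.\<close>

lemma representation_apply_inverse:
  assumes G: "topological_group G T" and "representation G T X act h \<alpha>"
    and "g \<in> carrier G" "x \<in> topspace X"
  shows "blinfun_apply (\<alpha> (act g x)) v = blinfun_apply (\<alpha> x) (blinfun_apply (h (inv\<^bsub>G\<^esub> g)) v)"
proof -
  interpret group_hom G Iso h
    using assms(2) topological_group.axioms(1)[OF G] group_Iso
    by (auto simp: group_hom_def group_hom_axioms_def representation_def)
  have "h g \<otimes>\<^bsub>Iso\<^esub> h (inv\<^bsub>G\<^esub> g) = \<one>\<^bsub>Iso\<^esub>"
    using assms(3) by (metis hom_mult hom_one G.inv_closed G.r_inv)
  then have "blinfun_apply (h g) (blinfun_apply (h (inv\<^bsub>G\<^esub> g)) v) = v"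
    unfolding Iso_def by (metis blinfun_apply_blinfun_compose blinfun_apply_id_blinfun
      monoid.select_convs(1,2))
  then show ?thesis
    using assms(2-4) by (simp add: representation_def dual_act_apply)
qed

lemma representation_norm:
  assumes "representation G T X act h \<alpha>" "g \<in> carrier G"
  shows "norm (blinfun_apply (h g) v) = norm v"
  using assms hom_in_carrier[of h G Iso g] by (auto simp: representation_def Iso_def)

lemma asplund_representation_GL2_constant:
  fixes h :: "real^2^2 \<Rightarrow> ('v::banach \<Rightarrow>\<^sub>L 'v)" and \<alpha> :: "real^2 \<Rightarrow> ('v \<Rightarrow>\<^sub>L real)"
  assumes asp: "asplund TYPE('v)" and rep: "representation GL GL_topology euclidean (*v) h \<alpha>"
    and xy: "x \<noteq> 0" "y \<noteq> 0"
  shows "\<alpha> x = \<alpha> y"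
proof -
  let ?det = "\<lambda>a b :: real^2. a$1 * b$2 - a$2 * b$1"
  have unit: "\<alpha> x v = \<alpha> y v" if v: "norm v \<le> 1" and d: "?det x y \<noteq> 0" for x y v
  proof -
    have "\<bar>\<alpha> x v - \<alpha> y v\<bar> < e" if e: "e > 0" for e
    proof -
      \<comment> \<open>Strong operator continuity is what makes the orbit map of \<open>v\<close>
        continuous, so that the orbit fits into a separable subspace.\<close>
      have "continuous_map GL_topology strong_operator_topology h"
        using rep by (simp add: representation_def Iso_topology_def continuous_map_in_subtopology)
      then have "continuous_on (carrier GL) (\<lambda>A. h A v)"
        by (simp add: GL_topology_def continuous_on_strong_operator_topo_iff_coordinatewise)
      then obtain W where W: "subspace W" "closed W" "separable_space (top_of_set W)"
        "(\<lambda>A. h A v) ` carrier GL \<subseteq> W"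
        using continuous_image_subset_separable_subspace by metis
      \<comment> \<open>Any two distinct vectors of this family are independent: their determinant
        is \<open>t - s\<close>.\<close>
      define p where "p t = (vector [1, t] :: real^2)" for t
      obtain s t where st: "s \<noteq> t"
        and close: "\<And>w. \<lbrakk>w \<in> W; norm w \<le> 1\<rbrakk> \<Longrightarrow> \<bar>\<alpha> (p s) w - \<alpha> (p t) w\<bar> < e"
        using asplund_uncountable_family_close_pair[OF asp W(1-3) e, of "\<alpha> \<circ> p"] by auto
      have "p s$1 * p t$2 \<noteq> p s$2 * p t$1" using st by (simp add: p_def)
      then obtain A where A: "invertible A" "A *v p s = x" "A *v p t = y"
        using GL2_transitive_on_bases d by (metis right_minus_eq)
      then have GL: "A \<in> carrier GL" by (simp add: GL_def)
      then have B: "inv\<^bsub>GL\<^esub> A \<in> carrier GL" by (rule group.inv_closed[OF group_GL])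
      \<comment> \<open>The matrix \<open>A\<close> depends on \<open>s\<close> and
        \<open>t\<close>, which were chosen first; the closeness still applies because
        \<open>W\<close> contains the whole orbit of \<open>v\<close>.\<close>
      let ?w = "h (inv\<^bsub>GL\<^esub> A) v"
      have "?w \<in> W" using W(4) B by blast
      moreover have "norm ?w \<le> 1" using v representation_norm[OF rep B, of v] by simp
      moreover have "\<alpha> x v = \<alpha> (p s) ?w" "\<alpha> y v = \<alpha> (p t) ?w"
        using representation_apply_inverse[OF topological_group_GL rep GL] A(2,3) by auto
      ultimately show ?thesis using close by simp
    qed
    \<comment> \<open>Were the two values different, \<open>e\<close> could be the absolute value of
      their difference.\<close>
    then show ?thesis
      using linorder_neqE_linordered_idom zero_less_abs_iff by (metis less_irrefl right_minus_eq)
  qed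
  have indep: "\<alpha> x = \<alpha> y" if "?det x y \<noteq> 0" for x y
  proof (rule blinfun_eqI)
    fix v :: 'v
    let ?u = "inverse (norm v) *\<^sub>R v"
    have "norm ?u \<le> 1" by (cases "v = 0") simp_all
    then have "\<alpha> x ?u = \<alpha> y ?u" using that by (rule unit)
    then show "\<alpha> x v = \<alpha> y v" by (cases "v = 0") (auto simp: blinfun.scaleR_right)
  qed
  \<comment> \<open>Since \<open>x\<close> and \<open>y\<close> may be parallel, they are compared
    through a third vector independent of both. The determinants with the candidates are, up to
    sign, the first coordinate, the second coordinate and the difference of the two.\<close>
  obtain z where "?det x z \<noteq> 0" "?det y z \<noteq> 0"
  proof -
    have nz: "a$1 \<noteq> 0 \<or> a$2 \<noteq> 0" if "a \<noteq> 0" for a :: "real^2"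
      using that by (auto simp: vec_eq_iff forall_2)
    let ?z1 = "vector [0, 1] :: real^2" and ?z2 = "vector [1, 0] :: real^2"
    let ?z3 = "vector [1, 1] :: real^2"
    consider "x$1 \<noteq> 0" "y$1 \<noteq> 0" | "x$2 \<noteq> 0" "y$2 \<noteq> 0"
      | "x$1 = 0" "y$2 = 0" | "x$2 = 0" "y$1 = 0"
      using nz[OF xy(1)] nz[OF xy(2)] by blast
    then show thesis
    proof cases
      case 1 then show ?thesis using that[of ?z1] by simp
    next
      case 2 then show ?thesis using that[of ?z2] by simp
    qed (use that[of ?z3] nz xy in auto)
  qed
  then show ?thesis using indep by metis
qed

section \<open>Reduction of the conjugation actions to the linear action\<close>

lemma representation_pullback:
  assumes rep: "representation G T X act h \<alpha>"
    and \<phi>: "\<phi> \<in> hom G' G" "continuous_map T' T \<phi>"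
    and \<iota>: "continuous_map X' X \<iota>"
    and equi: "\<And>g x. \<lbrakk>g \<in> carrier G'; x \<in> topspace X'\<rbrakk> \<Longrightarrow> \<iota> (act' g x) = act (\<phi> g) (\<iota> x)"
  shows "representation G' T' X' act' (h \<circ> \<phi>) (\<alpha> \<circ> \<iota>)"
proof -
  have \<iota>X: "\<iota> x \<in> topspace X" if "x \<in> topspace X'" for x
    using \<iota> that continuous_map_funspace by blast
  then have "(\<alpha> \<circ> \<iota>) ` topspace X' \<subseteq> \<alpha> ` topspace X" by auto
  then have "bounded ((\<alpha> \<circ> \<iota>) ` topspace X')"
    using rep bounded_subset unfolding representation_def by blast
  moreover have "\<phi> g \<in> carrier G" if "g \<in> carrier G'" for g
    using hom_in_carrier[OF \<phi>(1) that] .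
  ultimately show ?thesis
    using rep \<iota>X hom_compose[OF \<phi>(1)] continuous_map_compose[OF \<phi>(2)]
      continuous_map_compose[OF \<iota>] equi
    unfolding representation_def by auto
qed

lemma hom_conjugation:
  assumes "group G" "group H" "\<phi> \<in> hom G H" "g \<in> carrier G" "x \<in> carrier G"
  shows "\<phi> (conjugation G g x) = conjugation H (\<phi> g) (\<phi> x)"
proof -
  interpret group_hom G H \<phi>
    using assms(1-3) by (simp add: group_hom_def group_hom_axioms_def)
  show ?thesis using assms(4,5) by (simp add: conjugation_def)
qed

lemma embedding_map_imp_inj_on: "embedding_map X Y f \<Longrightarrow> inj_on f (topspace X)"
  by (simp add: embedding_map_def homeomorphic_eq_everything_map)

lemma Aff_topology_eq:
  "Aff_topology = top_of_set (carrier (Aff :: ((real^'n) \<times> (real^'n^'n)) monoid))"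
  unfolding Aff_topology_def GL_topology_def Aff_def
  by (simp add: prod_topology_subtopology(2) flip: euclidean_product_topology)

text \<open>Stating this for injective rather than embedding \<open>\<alpha>\<close> lets it apply
  to pullbacks, whose injectivity is immediate.\<close>

lemma not_representation_conjugation_Aff:
  fixes h :: "(real^2) \<times> (real^2^2) \<Rightarrow> ('v::banach \<Rightarrow>\<^sub>L 'v)"
  assumes asp: "asplund TYPE('v)"
    and rep: "representation Aff Aff_topology Aff_topology (conjugation Aff) h \<alpha>"
    and inj: "inj_on \<alpha> (carrier Aff)"
  shows False
proof -
  \<comment> \<open>Conjugating the translation by \<open>x\<close> with the linear map
    \<open>A\<close> gives the translation by \<open>A *v x\<close>.\<close>
  let ?\<phi> = "\<lambda>A :: real^2^2. (0 :: real^2, A)" and ?\<iota> = "\<lambda>x :: real^2. (x, mat 1 :: real^2^2)"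
  have one: "mat 1 \<in> carrier (GL :: (real^2^2) monoid)"
    using group.is_monoid[OF group_GL] monoid.one_closed by (fastforce simp: GL_def)
  have "representation GL GL_topology euclidean (*v) (h \<circ> ?\<phi>) (\<alpha> \<circ> ?\<iota>)"
  proof (rule representation_pullback[OF rep])
    show "?\<phi> \<in> hom GL Aff" by (auto simp: hom_def GL_def Aff_def)
    show "continuous_map GL_topology Aff_topology ?\<phi>"
      unfolding Aff_topology_def by (simp add: continuous_map_pairedI)
    show "continuous_map euclidean Aff_topology ?\<iota>"
      unfolding Aff_topology_def using one
      by (intro continuous_map_pairedI) (auto simp: GL_topology_def)
    fix A :: "real^2^2" and x :: "real^2"
    assume A: "A \<in> carrier GL"
    have "A ** matrix_inv A = mat 1"
      using group.r_inv[OF group_GL A] inv_GL[OF A] by (simp add: GL_def)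
    then show "?\<iota> (A *v x) = conjugation Aff (?\<phi> A) (?\<iota> x)"
      unfolding conjugation_def inv_Aff[OF A] by (simp add: Aff_def)
  qed
  then have "(\<alpha> \<circ> ?\<iota>) (axis 1 1) = (\<alpha> \<circ> ?\<iota>) (axis 2 1)"
    by (rule asplund_representation_GL2_constant[OF asp]) auto
  moreover have "?\<iota> x \<in> carrier Aff" for x using one by (simp add: Aff_def)
  ultimately have "?\<iota> (axis 1 1) = ?\<iota> (axis 2 1)" using inj by (auto dest: inj_onD)
  then show False by (simp add: axis_eq_axis)
qed

text \<open>The standard embedding of the affine group: the plane is identified with the vectors of
  third coordinate 1.\<close>

definition affine_matrix :: "(real^2) \<times> (real^2^2) \<Rightarrow> real^3^3" where
  "affine_matrix = (\<lambda>(v, A). vector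
     [vector [A$1$1, A$1$2, v$1], vector [A$2$1, A$2$2, v$2], vector [0, 0, 1]])"

lemma inj_affine_matrix: "inj affine_matrix"
  by (rule injI) (auto simp: affine_matrix_def vec_eq_iff forall_2 forall_3)

lemma affine_matrix_hom: "affine_matrix \<in> hom Aff GL"
proof (rule homI)
  show "affine_matrix x \<in> carrier GL" if "x \<in> carrier Aff" for x
    \<comment> \<open>Expansion along the last row shows that the determinant is that of the linear
      part.\<close>
    using that by (auto simp: affine_matrix_def GL_def Aff_def invertible_det_nz det_2 det_3)
  show "affine_matrix (x \<otimes>\<^bsub>Aff\<^esub> y) = affine_matrix x \<otimes>\<^bsub>GL\<^esub> affine_matrix y" for x y
    by (cases x; cases y) (simp add: affine_matrix_def GL_def Aff_def vec_eq_iff forall_3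
      matrix_matrix_mult_def matrix_vector_mult_def sum_2 sum_3 algebra_simps)
qed

lemma continuous_map_affine_matrix: "continuous_map Aff_topology GL_topology affine_matrix"
proof -
  have "continuous_on UNIV (\<lambda>x. affine_matrix x $ i $ j)" for i j
  proof -
    have "\<forall>i j. continuous_on UNIV (\<lambda>x. affine_matrix x $ i $ j)"
      unfolding forall_3 by (simp add: affine_matrix_def case_prod_unfold continuous_intros)
    then show ?thesis by blast
  qed
  then have "continuous_on UNIV (\<lambda>x. \<chi> i j. affine_matrix x $ i $ j)"
    by (intro continuous_on_vec_lambda)
  then have "continuous_on UNIV affine_matrix" by simp
  then show ?thesis
    using hom_in_carrier[OF affine_matrix_hom]
    by (auto simp: Aff_topology_eq GL_topology_def continuous_map_in_subtopology
      intro: continuous_on_subset)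
qed

theorem proposition3p9:
  shows
    "\<not> asplund_representable_on TYPE('v::banach)
         (GL :: (real^2^2) monoid) GL_topology (euclidean :: (real^2) topology) (*v)
     \<and> \<not> asplund_representable_on TYPE('v)
         (Aff :: ((real^2) \<times> (real^2^2)) monoid) Aff_topology Aff_topology (conjugation Aff)
     \<and> \<not> asplund_representable_on TYPE('v)
         (GL :: (real^3^3) monoid) GL_topology GL_topology (conjugation GL)"
proof (intro conjI notI)
  assume "asplund_representable_on TYPE('v)
    (GL :: (real^2^2) monoid) GL_topology (euclidean :: (real^2) topology) (*v)"
  then obtain h :: "real^2^2 \<Rightarrow> ('v \<Rightarrow>\<^sub>L 'v)" and \<alpha> where asp: "asplund TYPE('v)"
    and rep: "representation GL GL_topology euclidean (*v) h \<alpha>"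
    and emb: "embedding_map euclidean weak_star_topology \<alpha>"
    unfolding asplund_representable_on_def proper_representation_def by blast
  have "\<alpha> (axis 1 1) = \<alpha> (axis 2 1)"
    by (rule asplund_representation_GL2_constant[OF asp rep]) auto
  then have "axis 1 1 = (axis 2 1 :: real^2)"
    using embedding_map_imp_inj_on[OF emb] by (auto dest: injD)
  then show False by (simp add: axis_eq_axis)
next
  assume "asplund_representable_on TYPE('v)
    (Aff :: ((real^2) \<times> (real^2^2)) monoid) Aff_topology Aff_topology (conjugation Aff)"
  then show False
    unfolding asplund_representable_on_def proper_representation_def
    by (metis not_representation_conjugation_Aff embedding_map_imp_inj_on
      topological_group.topspace_eq topological_group_Aff)
next
  assume "asplund_representable_on TYPE('v)
    (GL :: (real^3^3) monoid) GL_topology GL_topology (conjugation GL)"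
  then obtain h :: "real^3^3 \<Rightarrow> ('v \<Rightarrow>\<^sub>L 'v)" and \<alpha> where asp: "asplund TYPE('v)"
    and rep: "representation GL GL_topology GL_topology (conjugation GL) h \<alpha>"
    and emb: "embedding_map GL_topology weak_star_topology \<alpha>"
    unfolding asplund_representable_on_def proper_representation_def by blast
  \<comment> \<open>A homomorphism intertwines conjugations, so \<open>affine_matrix\<close> serves
    both as the group map and as the map of spaces.\<close>
  have "representation Aff Aff_topology Aff_topology (conjugation Aff)
    (h \<circ> affine_matrix) (\<alpha> \<circ> affine_matrix)"
    by (rule representation_pullback[OF rep affine_matrix_hom continuous_map_affine_matrix
        continuous_map_affine_matrix])
      (simp add: hom_conjugation[OF group_Aff group_GL affine_matrix_hom]
        topological_group.topspace_eq[OF topological_group_Aff])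
  moreover have "inj_on (\<alpha> \<circ> affine_matrix) (carrier Aff)"
  proof (rule comp_inj_on)
    show "inj_on affine_matrix (carrier Aff)" using inj_affine_matrix by (rule inj_on_subset) simp
    have "affine_matrix ` carrier Aff \<subseteq> topspace GL_topology"
      using hom_in_carrier[OF affine_matrix_hom] by (auto simp: GL_topology_def)
    then show "inj_on \<alpha> (affine_matrix ` carrier Aff)"
      using embedding_map_imp_inj_on[OF emb] inj_on_subset by blast
  qed
  ultimately show False by (rule not_representation_conjugation_Aff[OF asp])
qed

end
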